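(* Let $R$ be a ring, $m\ge 3$, and let $\mathcal{C}=(c_{i,j})$ be a noncommutative frieze pattern of height $m-3$ over $R$ (indices modulo $m$, with $c_{i,i}=0$ for all $i$). Then for every neighbouring $3\times 3$-submatrix $$M=\begin{pmatrix} c_{i,j} & c_{i,j+1} & c_{i,j+2} \\c_{i+1,j} & c_{i+1,j+1} & c_{i+1,j+2} \\ c_{i+2,j} & c_{i+2,j+1} & c_{i+2,j+2} \end{pmatrix}$$ of the array $\mathcal{C}$ (that is, for all integers $i,j$ with $i+2\le j\le i+m-2$), the quasideterminant $|M|_{3,3}$ is equal to $0$. In particular, every noncommutative frieze pattern is tame.
   Context: $R$ is an associative unital, not necessarily commutative, ring and $R^{\ast}$ is its group of invertible elements. Let $m\ge 3$. The vertices of an $m$-gon are numbered consecutively $0,1,\dots,m-1$, and indices are taken modulo $m$. A noncommutative frieze pattern of height $m-3$ over $R$ is a family of invertible elements $c_{i,j}\in R^{\ast}$, one for each ordered pair of distinct vertices $i,j$ (arranged in an array whose row $i$ is $0=c_{i,i},c_{i,i+1},c_{i,i+2},\dots,c_{i,i+m-1},c_{i,i+m}=0$, each row being shifted one step to the right of the previous one, so that equal column indices are aligned), satisfying: Local triangle relations, for all three consecutive vertices $i,i+1,i+2$: $$c_{i+1,i+2}c_{i,i+2}^{-1}c_{i,i+1} = c_{i+1,i}c_{i+2,i}^{-1}c_{i+2,i+1}.$$ Local noncommutative exchange relations, for all quadrangles with (four distinct) vertices $i,i+1,j,j+1$: $$c_{j,i} = c_{j,j+1}c_{i+1,j+1}^{-1}c_{i+1,i}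 + c_{j,i+1} c_{j+1,i+1}^{-1}c_{j+1,i},$$ $$c_{i,j} = c_{i,i+1}c_{j+1,i+1}^{-1}c_{j+1,j} + c_{i,j+1} c_{i+1,j+1}^{-1}c_{i+1,j},$$ $$c_{i+1,j+1} = c_{i+1,i}c_{j,i}^{-1}c_{j,j+1} + c_{i+1,j} c_{i,j}^{-1}c_{i,j+1},$$ $$c_{j+1,i+1} = c_{j+1,j}c_{i,j}^{-1}c_{i,i+1} + c_{j+1,i} c_{j,i}^{-1}c_{j,i+1}.$$ Quasideterminant: for an $n\times n$ matrix $A=(a_{p,q})$ over $R$, let $A^{p,q}$ be $A$ with row $p$ and column $q$ deleted. If $A^{p,q}$ is invertible, then $|A|_{p,q} = a_{p,q} - r_p^q (A^{p,q})^{-1} c_q^p$, where $r_p^q$ is the $p$th row of $A$ with its $q$th entry deleted and $c_q^p$ is the $q$th column of $A$ with its $p$th entry deleted. For the matrices $M$ in the claim, the upper left $2\times 2$ block $M^{3,3}$ is invertible, so $|M|_{3,3}$ is defined. A noncommutative frieze pattern is called tame if $|M|_{3,3}=0$ for every neighbouring $3\times 3$-submatrix $M$ (three consecutive rows, three consecutive columns) of the array. *)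

theory Defs
  imports "Jordan_Normal_Form.Determinant" "HOL-Number_Theory.Cong"
begin

(* Associative unital, not necessarily commutative rings are types of sort {ring, monoid_mult}.
   Unlike ring_1, this does not impose 0 \<noteq> 1.  The library notions "inverts_mat" and
   "invertible_mat" need 0 \<noteq> 1, so their unfolded forms are used below. *)

definition inverse_pair :: "'a::monoid_mult \<Rightarrow> 'a \<Rightarrow> bool" where
  "inverse_pair x y \<longleftrightarrow> x * y = 1 \<and> y * x = 1"

definition ring_units :: "'a::monoid_mult set" where
  "ring_units = {x. \<exists>y. inverse_pair x y}"

(* Meaningful for x in ring_units only; two-sided inverses are unique. *)
definition uinv :: "'a::monoid_mult \<Rightarrow> 'a" where
  "uinv x = (THE y. inverse_pair x y)"

definition mat_inverse_pair :: "'a::{ring,monoid_mult} mat \<Rightarrow> 'a mat \<Rightarrow> bool" where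
  "mat_inverse_pair A B \<longleftrightarrow> A * B = 1\<^sub>m (dim_row A) \<and> B * A = 1\<^sub>m (dim_row B)"

definition mat_unit :: "'a::{ring,monoid_mult} mat \<Rightarrow> bool" where
  "mat_unit A \<longleftrightarrow> square_mat A \<and> (\<exists>B. mat_inverse_pair A B)"

definition mat_uinv :: "'a::{ring,monoid_mult} mat \<Rightarrow> 'a mat" where
  "mat_uinv A = (THE B. mat_inverse_pair A B)"

definition row_delete :: "'a mat \<Rightarrow> nat \<Rightarrow> nat \<Rightarrow> 'a vec" where
  "row_delete A p q = vec (dim_col A - 1) (\<lambda>l. A $$ (p, if l < q then l else Suc l))"

definition col_delete :: "'a mat \<Rightarrow> nat \<Rightarrow> nat \<Rightarrow> 'a vec" where
  "col_delete A p q = vec (dim_row A - 1) (\<lambda>k. A $$ (if k < p then k else Suc k, q))"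

(* The quasideterminant |A|_{p,q} exists only if A with row p and column q deleted is invertible;
   "quasidet A p q" carries no information otherwise.  Matrix indices start at 0. *)
definition quasidet_defined :: "'a::{ring,monoid_mult} mat \<Rightarrow> nat \<Rightarrow> nat \<Rightarrow> bool" where
  "quasidet_defined A p q \<longleftrightarrow> mat_unit (mat_delete A p q)"

definition quasidet :: "'a::{ring,monoid_mult} mat \<Rightarrow> nat \<Rightarrow> nat \<Rightarrow> 'a" where
  "quasidet A p q =
     A $$ (p, q) - row_delete A p q \<bullet> (mat_uinv (mat_delete A p q) *\<^sub>v col_delete A p q)"

(* Vertices are represented by arbitrary integers, taken modulo m. *)
definition nc_frieze :: "nat \<Rightarrow> (int \<Rightarrow> int \<Rightarrow> 'a::{ring,monoid_mult}) \<Rightarrow> bool" where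
  "nc_frieze m c \<longleftrightarrow>
     m \<ge> 3 \<and>
     (\<forall>i j i' j'. [i = i'] (mod int m) \<longrightarrow> [j = j'] (mod int m) \<longrightarrow> c i j = c i' j') \<and>
     (\<forall>i. c i i = 0) \<and>
     (\<forall>i j. \<not> [i = j] (mod int m) \<longrightarrow> c i j \<in> ring_units) \<and>
     (\<forall>i. c (i+1) (i+2) * uinv (c i (i+2)) * c i (i+1) =
          c (i+1) i * uinv (c (i+2) i) * c (i+2) (i+1)) \<and>
     (\<forall>i j. distinct (map (\<lambda>k. k mod int m) [i, i+1, j, j+1]) \<longrightarrow>
        c j i = c j (j+1) * uinv (c (i+1) (j+1)) * c (i+1) i
              + c j (i+1) * uinv (c (j+1) (i+1)) * c (j+1) i \<and>
        c i j = c i (i+1) * uinv (c (j+1) (i+1)) * c (j+1) j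
              + c i (j+1) * uinv (c (i+1) (j+1)) * c (i+1) j \<and>
        c (i+1) (j+1) = c (i+1) i * uinv (c j i) * c j (j+1)
              + c (i+1) j * uinv (c i j) * c i (j+1) \<and>
        c (j+1) (i+1) = c (j+1) j * uinv (c i j) * c i (i+1)
              + c (j+1) i * uinv (c j i) * c j (i+1))"

definition neighbouring_mat :: "(int \<Rightarrow> int \<Rightarrow> 'a) \<Rightarrow> int \<Rightarrow> int \<Rightarrow> 'a mat" where
  "neighbouring_mat c i j = mat 3 3 (\<lambda>(p, q). c (i + int p) (j + int q))"

(* Row r of the array consists of the entries in columns r, ..., r + m. *)
definition in_array :: "nat \<Rightarrow> int \<Rightarrow> int \<Rightarrow> bool" where
  "in_array m r s \<longleftrightarrow> r \<le> s \<and> s \<le> r + int m"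

definition tame :: "nat \<Rightarrow> (int \<Rightarrow> int \<Rightarrow> 'a::{ring,monoid_mult}) \<Rightarrow> bool" where
  "tame m c \<longleftrightarrow>
     (\<forall>i j. (\<forall>r\<in>{i..i+2}. \<forall>s\<in>{j..j+2}. in_array m r s) \<longrightarrow>
        quasidet_defined (neighbouring_mat c i j) 2 2 \<and>
        quasidet (neighbouring_mat c i j) 2 2 = 0)"

end

theory Submission
  imports Defs
begin

text \<open>
  The quasideterminant at the lower right corner vanishes as soon as one right linear combination
  of the first two columns equals the third column, in all three rows at once (lemma
  \<open>quasidet_eq_0I\<close>).  The frieze provides such a combination: writing \<open>x'\<close> for the inverse of
  \<open>x\<close>, the entries satisfy

    \<open>c r (j+2) = c r (j+1) * (c j (j+1))' * c j (j+2) - c r j * (c (j+1) j)' * c (j+1) (j+2)\<close>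

  with coefficients on the right that depend on \<open>j\<close> only.  This is the noncommutative form of the
  linear recursion along the rows of a Conway-Coxeter frieze (lemma \<open>linear_recursion\<close>).  It holds
  for \<open>r = j+2, \<dots>, j+m\<close>, while for \<open>r = j+1\<close> the two sides differ by their sign; the bounds on \<open>i\<close>
  and \<open>j\<close> in the theorem say exactly that the rows \<open>i, i+1, i+2\<close> stay clear of \<open>j+1\<close> modulo \<open>m\<close>.

  The recursion is proved by induction on \<open>r\<close>.  For \<open>r = j+2\<close> it is a local triangle relation.
  In the step, the exchange relations express the row \<open>r+1\<close> through the row \<open>r\<close>, and the correction
  terms cancel if the triangle relation holds for the vertices \<open>j, j+1, r\<close> (lemma
  \<open>recursion_transfer\<close>).  That relation is given only for consecutive vertices; for arbitrary
  \<open>r\<close> it follows by another induction (lemmas \<open>triangle_transfer\<close> and \<open>triangle_relation\<close>).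

  The upper left block is invertible because its pivot \<open>c i j\<close> is a unit and, by an exchange
  relation, the Schur complement of the pivot is a product of units.
\<close>

section \<open>Units\<close>

lemma inverse_pair_unique:
  assumes "inverse_pair x y" "inverse_pair x z"
  shows "y = z"
proof -
  have "y = y * (x * z)" using assms by (simp add: inverse_pair_def)
  also have "\<dots> = (y * x) * z" by (simp add: mult.assoc)
  also have "\<dots> = z" using assms by (simp add: inverse_pair_def)
  finally show ?thesis .
qed

lemma inverse_pair_uinv:
  assumes "x \<in> ring_units"
  shows "inverse_pair x (uinv x)"
proof -
  obtain y where y: "inverse_pair x y" using assms by (auto simp: ring_units_def)
  have "uinv x = y"
    unfolding uinv_def by (rule the_equality) (rule y, erule inverse_pair_unique[OF _ y])
  with y show ?thesis by simp
qed

lemma unit_cancel: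
  assumes "x \<in> ring_units"
  shows "x * uinv x = 1" "uinv x * x = 1" "x * (uinv x * y) = y" "uinv x * (x * y) = y"
proof -
  show 1: "x * uinv x = 1" and 2: "uinv x * x = 1"
    using inverse_pair_uinv[OF assms] by (simp_all add: inverse_pair_def)
  show "x * (uinv x * y) = y" "uinv x * (x * y) = y"
    using 1 2 by (simp_all add: mult.assoc[symmetric])
qed

lemma ring_units_uinv: "x \<in> ring_units \<Longrightarrow> uinv x \<in> ring_units"
  using inverse_pair_uinv by (auto simp: ring_units_def inverse_pair_def)

lemma ring_units_mult:
  assumes "x \<in> ring_units" "y \<in> ring_units"
  shows "x * y \<in> ring_units"
proof -
  have "inverse_pair (x * y) (uinv y * uinv x)"
    using assms by (simp add: inverse_pair_def unit_cancel mult.assoc)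
  then show ?thesis by (auto simp: ring_units_def)
qed

section \<open>Invertible matrices and quasideterminants\<close>

text \<open>The identity matrix is neutral also over the trivial ring, which the entry type of a frieze
  includes.\<close>

lemma one_mat_mult:
  fixes A :: "'a::{ring,monoid_mult} mat"
  assumes "A \<in> carrier_mat n k"
  shows "1\<^sub>m n * A = A" "A * 1\<^sub>m k = A"
proof -
  show "1\<^sub>m n * A = A"
  proof (rule eq_matI)
    fix i l assume *: "i < dim_row A" "l < dim_col A"
    have "(1\<^sub>m n * A) $$ (i, l) = (\<Sum>x = 0..<n. (if i = x then 1 else 0) * A $$ (x, l))"
      using * assms by (auto simp: scalar_prod_def intro!: sum.cong)
    also have "\<dots> = (\<Sum>x = 0..<n. if i = x then A $$ (x, l) else 0)"
      by (intro sum.cong) auto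
    finally show "(1\<^sub>m n * A) $$ (i, l) = A $$ (i, l)" using * assms by simp
  qed (use assms in auto)
  show "A * 1\<^sub>m k = A"
  proof (rule eq_matI)
    fix i l assume *: "i < dim_row A" "l < dim_col A"
    have "(A * 1\<^sub>m k) $$ (i, l) = (\<Sum>x = 0..<k. A $$ (i, x) * (if x = l then 1 else 0))"
      using * assms by (auto simp: scalar_prod_def intro!: sum.cong)
    also have "\<dots> = (\<Sum>x = 0..<k. if x = l then A $$ (i, x) else 0)"
      by (intro sum.cong) auto
    finally show "(A * 1\<^sub>m k) $$ (i, l) = A $$ (i, l)" using * assms by simp
  qed (use assms in auto)
qed

lemma one_mat_mult_vec:
  fixes v :: "'a::{ring,monoid_mult} vec"
  assumes "v \<in> carrier_vec n"
  shows "1\<^sub>m n *\<^sub>v v = v"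
proof (rule eq_vecI)
  fix i assume *: "i < dim_vec v"
  have "(1\<^sub>m n *\<^sub>v v) $ i = (\<Sum>x = 0..<n. (if i = x then 1 else 0) * v $ x)"
    using * assms by (auto simp: scalar_prod_def intro!: sum.cong)
  also have "\<dots> = (\<Sum>x = 0..<n. if i = x then v $ x else 0)"
    by (intro sum.cong) auto
  finally show "(1\<^sub>m n *\<^sub>v v) $ i = v $ i" using * assms by simp
qed (use assms in auto)

lemma mat_inverse_pair_carrier:
  assumes "mat_inverse_pair A B" "A \<in> carrier_mat n n"
  shows "B \<in> carrier_mat n n"
proof -
  have "dim_col (A * B) = dim_row A" "dim_col (B * A) = dim_row B"
    using assms by (auto simp: mat_inverse_pair_def)
  then show ?thesis using assms by auto
qed

lemma mat_inverse_pair_unique: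
  assumes "mat_inverse_pair A B" "mat_inverse_pair A C" "A \<in> carrier_mat n n"
  shows "B = C"
proof -
  have BC: "B \<in> carrier_mat n n" "C \<in> carrier_mat n n"
    using assms mat_inverse_pair_carrier by blast+
  have "B = B * (A * C)" using assms BC by (auto simp: mat_inverse_pair_def one_mat_mult)
  also have "\<dots> = (B * A) * C" using BC assms(3) by (simp add: assoc_mult_mat)
  also have "\<dots> = C" using assms BC by (auto simp: mat_inverse_pair_def one_mat_mult)
  finally show ?thesis .
qed

lemma mat_inverse_pair_mat_uinv:
  assumes "mat_unit A"
  shows "mat_inverse_pair A (mat_uinv A)"
proof -
  obtain B where B: "mat_inverse_pair A B" and A: "A \<in> carrier_mat (dim_row A) (dim_row A)"
    using assms by (auto simp: mat_unit_def)
  have "mat_uinv A = B"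
    unfolding mat_uinv_def
    by (rule the_equality) (rule B, erule mat_inverse_pair_unique[OF _ B A])
  with B show ?thesis by simp
qed

text \<open>The vector \<open>v\<close> lists the coefficients that produce the deleted column from the remaining ones;
  \<open>v\<close> is therefore the inverse of the submatrix applied to that column.\<close>

lemma quasidet_eq_0I:
  fixes A :: "'a::{ring,monoid_mult} mat"
  assumes unit: "mat_unit (mat_delete A p q)"
    and v: "v \<in> carrier_vec (dim_col A - 1)"
    and col: "mat_delete A p q *\<^sub>v v = col_delete A p q"
    and row: "row_delete A p q \<bullet> v = A $$ (p, q)"
  shows "quasidet A p q = 0"
proof -
  let ?D = "mat_delete A p q"
  let ?n = "dim_col A - 1"
  have D: "?D \<in> carrier_mat ?n ?n"
    using unit by (auto simp: mat_unit_def mat_delete_def)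
  have pair: "mat_inverse_pair ?D (mat_uinv ?D)"
    using unit by (rule mat_inverse_pair_mat_uinv)
  have B: "mat_uinv ?D \<in> carrier_mat ?n ?n"
    using pair D by (rule mat_inverse_pair_carrier)
  have "mat_uinv ?D *\<^sub>v (?D *\<^sub>v v) = (mat_uinv ?D * ?D) *\<^sub>v v"
    using B D v by (simp add: assoc_mult_mat_vec)
  also have "\<dots> = v"
    using pair B v by (auto simp: mat_inverse_pair_def one_mat_mult_vec)
  finally have "mat_uinv ?D *\<^sub>v col_delete A p q = v"
    unfolding col .
  then show ?thesis
    by (simp add: quasidet_def row)
qed

lemma scalar_prod_vec2: "dim_vec v = 2 \<Longrightarrow> u \<bullet> v = u $ 0 * v $ 0 + u $ 1 * v $ 1"
  by (simp add: scalar_prod_def numeral_2_eq_2)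

text \<open>Block elimination: the inverse is built from the inverses of the pivot \<open>a\<close> and of its Schur
  complement \<open>s\<close>.\<close>

lemma mat_unit_2x2:
  fixes A :: "'a::{ring,monoid_mult} mat"
  assumes A: "A \<in> carrier_mat 2 2"
    and entries: "A $$ (0, 0) = a" "A $$ (0, 1) = b" "A $$ (1, 0) = d" "A $$ (1, 1) = e"
    and a: "a \<in> ring_units"
    and s: "e - d * uinv a * b \<in> ring_units"
  shows "mat_unit A"
proof -
  define a' where "a' = uinv a"
  define s where "s = e - d * a' * b"
  define s' where "s' = uinv s"
  have inv: "a * (a' * y) = y" "a' * (a * y) = y" "a * a' = 1" "a' * a = 1"
      "s * (s' * y) = y" "s' * (s * y) = y" "s * s' = 1" "s' * s = 1" for y
    using unit_cancel[OF a] unit_cancel[OF s] by (simp_all add: a'_def s_def s'_def)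
  have e: "e = s + d * a' * b"
    by (simp add: s_def)
  define B where "B = mat 2 2 (\<lambda>(p, q).
     if p = 0 then (if q = 0 then a' + a' * b * s' * d * a' else - (a' * b * s'))
     else (if q = 0 then - (s' * d * a') else s'))"
  have B: "B \<in> carrier_mat 2 2" and B_entries:
      "B $$ (0, 0) = a' + a' * b * s' * d * a'" "B $$ (0, 1) = - (a' * b * s')"
      "B $$ (1, 0) = - (s' * d * a')" "B $$ (1, 1) = s'"
    by (simp_all add: B_def)
  have product: "(X * Y) $$ (p, q) = X $$ (p, 0) * Y $$ (0, q) + X $$ (p, 1) * Y $$ (1, q)"
    if "X \<in> carrier_mat 2 2" "Y \<in> carrier_mat 2 2" "p < 2" "q < 2" for X Y :: "'a mat" and p q
    using that by (simp add: scalar_prod_vec2)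
  have ident: "Z = 1\<^sub>m 2" if "Z \<in> carrier_mat 2 2" "Z $$ (0, 0) = 1" "Z $$ (0, 1) = 0"
      "Z $$ (1, 0) = 0" "Z $$ (1, 1) = 1" for Z :: "'a mat"
    by (rule eq_matI) (use that in \<open>auto simp: less_2_cases_iff\<close>)
  have "A * B = 1\<^sub>m 2"
  proof (rule ident)
    show "A * B \<in> carrier_mat 2 2" using A B by simp
  qed (simp_all only: product[OF A B] entries B_entries,
       simp_all add: e distrib_left distrib_right mult.assoc inv)
  moreover have "B * A = 1\<^sub>m 2"
  proof (rule ident)
    show "B * A \<in> carrier_mat 2 2" using A B by simp
  qed (simp_all only: product[OF B A] entries B_entries,
       simp_all add: e distrib_left distrib_right mult.assoc inv)
  ultimately have "mat_inverse_pair A B"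
    using A B by (simp add: mat_inverse_pair_def)
  then show ?thesis using A by (auto simp: mat_unit_def)
qed

section \<open>Propagation of relations from vertex to vertex\<close>

text \<open>Here \<open>j, k, r, s\<close> are the vertices \<open>j, j+1, r, r+1\<close>, and \<open>kr\<close> stands for the entry
  \<open>c k r\<close>, and so on.  Both sides of the conclusion solve the equation \<open>x * z = kr\<close> for \<open>x\<close>,
  with the same \<open>z\<close>: the left-hand side by the first exchange relation, the right-hand side by
  the second one combined with the triangle relation for \<open>j, k, r\<close>.  The left-hand side is a
  unit, hence so is \<open>z\<close>.\<close>

lemma triangle_transfer:
  fixes jr :: "'a::{ring,monoid_mult}"
  assumes units: "jk \<in> ring_units" "sk \<in> ring_units" "js \<in> ring_units" "ks \<in> ring_units"
      "sj \<in> ring_units" "jr \<in> ring_units" "kr \<in> ring_units"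
    and ex1: "jr = jk * uinv sk * sr + js * uinv ks * kr"
    and ex2: "sk = sr * uinv jr * jk + sj * uinv rj * rk"
    and triangle: "kr * uinv jr * jk = kj * uinv rj * rk"
  shows "ks * uinv js * jk = kj * uinv sj * sk"
proof -
  define z where "z = uinv jk * jr - uinv sk * sr"
  define x where "x = ks * uinv js * jk"
  define y where "y = kj * uinv sj * sk"
  have xu: "x \<in> ring_units"
    unfolding x_def using units by (intro ring_units_mult ring_units_uinv)
  have "js * uinv ks * kr = jk * z"
    using arg_cong[OF ex1, of "\<lambda>t. t - jk * uinv sk * sr"] units
    by (simp add: z_def algebra_simps unit_cancel)
  then have "x * z = ks * (uinv js * (js * uinv ks * kr))"
    by (simp add: x_def mult.assoc)
  then have xz: "x * z = kr"
    using units by (simp add: mult.assoc unit_cancel)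
  have "y = kj * uinv sj * sr * uinv jr * jk + kj * uinv rj * rk"
    unfolding y_def by (subst ex2) (use units in \<open>simp add: algebra_simps unit_cancel\<close>)
  also have "\<dots> = (y * uinv sk * sr + kr) * uinv jr * jk"
    using units triangle by (simp add: y_def algebra_simps unit_cancel)
  finally have "y * (uinv jk * jr) = (y * uinv sk * sr + kr) * uinv jr * jk * (uinv jk * jr)"
    by simp
  then have "y * (uinv jk * jr) = y * uinv sk * sr + kr"
    using units by (simp add: mult.assoc unit_cancel)
  then have yz: "y * z = kr"
    by (simp add: z_def algebra_simps)
  have "z = uinv x * kr"
    using xz xu unit_cancel(4) by metis
  then have zu: "z \<in> ring_units"
    using xu units by (auto intro: ring_units_mult ring_units_uinv)
  have "x = (x * z) * uinv z" using zu by (simp add: mult.assoc unit_cancel)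
  also have "\<dots> = y" using zu by (simp add: xz yz[symmetric] mult.assoc unit_cancel)
  finally show ?thesis by (simp add: x_def y_def)
qed

text \<open>The vertices are named as in the previous lemma, with \<open>l = j+2\<close> in addition; \<open>t\<close> is the
  coefficient \<open>uinv jk * jl\<close> of the recursion.  Substituting the recursion for \<open>rl\<close> into the
  second exchange relation gives \<open>- sk * uinv rk * rj * uinv kj * kl\<close>.  By the first exchange
  relation, \<open>sk * uinv rk * rj\<close> is \<open>sj\<close> plus a term that the triangle relation turns into
  \<open>sr * uinv kr * kj\<close>, and this term cancels the last summand of the second exchange relation.\<close>

lemma recursion_transfer:
  fixes rj :: "'a::{ring,monoid_mult}"
  assumes units: "rj \<in> ring_units" "rk \<in> ring_units" "kr \<in> ring_units" "kj \<in> ring_units"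
    and ex1: "sk = sj * uinv rj * rk + sr * uinv jr * jk"
    and ex2: "sl = sk * uinv rk * rl + sr * uinv kr * kl"
    and triangle: "kr * uinv jr * jk = kj * uinv rj * rk"
    and rec: "rl = rk * t - rj * (uinv kj * kl)"
  shows "sl = sk * t - sj * (uinv kj * kl)"
proof -
  have "uinv jr * jk = uinv kr * (kr * uinv jr * jk)"
    using units by (simp add: mult.assoc unit_cancel)
  then have "uinv jr * jk * uinv rk * rj = uinv kr * kj"
    unfolding triangle using units by (simp add: mult.assoc unit_cancel)
  then have "sk * uinv rk * rj = sj + sr * (uinv kr * kj)"
    unfolding ex1 using units by (simp add: algebra_simps unit_cancel)
  then have "sk * uinv rk * rj * (uinv kj * kl) = (sj + sr * (uinv kr * kj)) * (uinv kj * kl)"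
    by simp
  then show ?thesis
    unfolding ex2 rec using units by (simp add: algebra_simps unit_cancel)
qed

section \<open>Noncommutative frieze patterns\<close>

locale noncommutative_frieze =
  fixes m :: nat and c :: "int \<Rightarrow> int \<Rightarrow> 'a::{ring,monoid_mult}"
  assumes frieze: "nc_frieze m c"
begin

lemma periodic: "[i = i'] (mod int m) \<Longrightarrow> [j = j'] (mod int m) \<Longrightarrow> c i j = c i' j'"
  using frieze unfolding nc_frieze_def by blast

lemma diagonal: "c i i = 0"
  using frieze unfolding nc_frieze_def by blast

lemma not_cong:
  assumes "i < j" "j < i + int m"
  shows "\<not> [i = j] (mod int m)"
proof
  assume "[i = j] (mod int m)"
  then have "int m dvd j - i" by (simp add: cong_iff_dvd_diff dvd_diff_commute)
  then show False using assms zdvd_not_zless[of "j - i" "int m"] by auto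
qed

lemma unit:
  assumes "i < j" "j < i + int m"
  shows "c i j \<in> ring_units" "c j i \<in> ring_units"
  using not_cong[OF assms] frieze unfolding nc_frieze_def by (auto simp: cong_sym_eq)

lemma triangle_consecutive:
  "c (i+1) (i+2) * uinv (c i (i+2)) * c i (i+1) = c (i+1) i * uinv (c (i+2) i) * c (i+2) (i+1)"
  using frieze unfolding nc_frieze_def by blast

lemma exchange:
  assumes "j + 2 \<le> i" "i + 2 \<le> j + int m"
  shows "c j i = c j (j+1) * uinv (c (i+1) (j+1)) * c (i+1) i
              + c j (i+1) * uinv (c (j+1) (i+1)) * c (j+1) i"
    and "c (i+1) (j+1) = c (i+1) i * uinv (c j i) * c j (j+1)
              + c (i+1) j * uinv (c i j) * c i (j+1)"
proof -
  have "distinct (map (\<lambda>k. k mod int m) [i, i+1, j, j+1])"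
    using not_cong[of i "i+1"] not_cong[of j i] not_cong[of "j+1" i]
      not_cong[of j "i+1"] not_cong[of "j+1" "i+1"] not_cong[of j "j+1"] assms
    unfolding cong_def by auto
  then show "c j i = c j (j+1) * uinv (c (i+1) (j+1)) * c (i+1) i
              + c j (i+1) * uinv (c (j+1) (i+1)) * c (j+1) i"
    and "c (i+1) (j+1) = c (i+1) i * uinv (c j i) * c j (j+1)
              + c (i+1) j * uinv (c i j) * c i (j+1)"
    using frieze unfolding nc_frieze_def by blast+
qed

lemma triangle_relation:
  assumes "j + 2 \<le> r" "r < j + int m"
  shows "c (j+1) r * uinv (c j r) * c j (j+1) = c (j+1) j * uinv (c r j) * c r (j+1)"
  using assms
proof (induction r rule: int_ge_induct)
  case base
  show ?case by (rule triangle_consecutive)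
next
  case (step r)
  have bounds: "j + 2 \<le> r" "r + 2 \<le> j + int m" using step by auto
  show ?case
  proof (rule triangle_transfer)
    show "c j r = c j (j+1) * uinv (c (r+1) (j+1)) * c (r+1) r
        + c j (r+1) * uinv (c (j+1) (r+1)) * c (j+1) r"
      and "c (r+1) (j+1) = c (r+1) r * uinv (c j r) * c j (j+1)
        + c (r+1) j * uinv (c r j) * c r (j+1)"
      using exchange[OF bounds] by auto
    show "c (j+1) r * uinv (c j r) * c j (j+1) = c (j+1) j * uinv (c r j) * c r (j+1)"
      using step by simp
  qed (use bounds in \<open>auto intro: unit\<close>)
qed

text \<open>The last case \<open>r = j + m\<close> is separate because it is the row of the vertex \<open>j\<close> itself,
  where the recursion reduces to the cancellation of \<open>c j (j+1)\<close>.\<close>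

lemma linear_recursion:
  assumes "j + 2 \<le> r" "r \<le> j + int m"
  shows "c r (j+2) = c r (j+1) * (uinv (c j (j+1)) * c j (j+2))
                   - c r j * (uinv (c (j+1) j) * c (j+1) (j+2))"
proof (cases "r = j + int m")
  case True
  then have "c r k = c j k" for k
    by (intro periodic) (simp_all add: cong_def)
  moreover have "c j (j+1) \<in> ring_units" using True assms by (auto intro: unit)
  ultimately show ?thesis by (simp add: diagonal unit_cancel)
next
  case False
  then have "r < j + int m" using assms by simp
  with assms(1) show ?thesis
  proof (induction r rule: int_ge_induct)
    case base
    then have units: "c j (j+1) \<in> ring_units" "c (j+1) j \<in> ring_units" "c j (j+2) \<in> ring_units"
        "c (j+2) j \<in> ring_units"
      by (auto intro: unit)
    have "c (j+2) j * uinv (c (j+1) j) *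
        (c (j+1) (j+2) * uinv (c j (j+2)) * c j (j+1)) * uinv (c j (j+1)) * c j (j+2)
      = c (j+2) j * (uinv (c (j+1) j) * c (j+1) (j+2))"
      using units by (simp add: mult.assoc unit_cancel)
    moreover have "c (j+2) j * uinv (c (j+1) j) *
        (c (j+1) (j+2) * uinv (c j (j+2)) * c j (j+1)) * uinv (c j (j+1)) * c j (j+2)
      = c (j+2) (j+1) * (uinv (c j (j+1)) * c j (j+2))"
      unfolding triangle_consecutive using units by (simp add: mult.assoc unit_cancel)
    ultimately show ?case by (simp add: diagonal)
  next
    case (step r)
    show ?case
    proof (rule recursion_transfer)
      show "c (r+1) (j+1) = c (r+1) j * uinv (c r j) * c r (j+1)
          + c (r+1) r * uinv (c j r) * c j (j+1)"
        using exchange(2)[of j r] step by (simp add: add.commute)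
      show "c (r+1) (j+2) = c (r+1) (j+1) * uinv (c r (j+1)) * c r (j+2)
          + c (r+1) r * uinv (c (j+1) r) * c (j+1) (j+2)"
      proof (cases "r = j + 2")
        \<comment> \<open>The four vertices are not distinct here, but as \<open>c r (j+2) = 0\<close> the equation is trivial.\<close>
        case True
        then have "c (j+1) r \<in> ring_units" using step by (auto intro: unit)
        then show ?thesis using True by (simp add: diagonal unit_cancel mult.assoc)
      next
        case False
        then show ?thesis
          using exchange(2)[of "j+1" r] step by (simp add: add.commute)
      qed
      show "c (j+1) r * uinv (c j r) * c j (j+1) = c (j+1) j * uinv (c r j) * c r (j+1)"
        using triangle_relation step by simp
      show "c r (j+2) = c r (j+1) * (uinv (c j (j+1)) * c j (j+2))
          - c r j * (uinv (c (j+1) j) * c (j+1) (j+2))"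
        using step by simp
    qed (use step in \<open>auto intro: unit\<close>)
  qed
qed

lemma neighbouring_quasidet:
  assumes "i + 2 \<le> j" "j \<le> i + int m - 2"
  shows "quasidet_defined (neighbouring_mat c i j) 2 2"
    and "quasidet (neighbouring_mat c i j) 2 2 = 0"
proof -
  let ?M = "neighbouring_mat c i j"
  let ?D = "mat_delete ?M 2 2"
  have dims: "dim_row ?M = 3" "dim_col ?M = 3"
    by (simp_all add: neighbouring_mat_def)
  then have D: "?D \<in> carrier_mat 2 2"
    by auto
  have D_entry: "?D $$ (p, q) = c (i + int p) (j + int q)" if "p < 2" "q < 2" for p q
    using that by (auto simp: neighbouring_mat_def mat_delete_def)
  \<comment> \<open>Rows are shifted by one period, so that they lie in the range of the exchange relations and
    of the linear recursion.\<close>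
  have shift: "c (x + int m) y = c x y" "c x (y + int m) = c x y" for x y
    by (auto intro!: periodic simp: cong_def)
  have "c (i+1) (j+1) = c (i+1) i * uinv (c j i) * c j (j+1)
      + c (i+1) j * uinv (c i j) * c i (j+1)"
    using exchange(2)[of j "i + int m"] assms
    by (simp add: shift add.assoc add.commute[of "int m" 1]) (simp add: shift flip: add.assoc)
  then have "c (i+1) (j+1) - c (i+1) j * uinv (c i j) * c i (j+1)
      = c (i+1) i * uinv (c j i) * c j (j+1)"
    by simp
  also have "\<dots> \<in> ring_units"
    using assms by (intro ring_units_mult ring_units_uinv) (auto intro: unit)
  finally have "mat_unit ?D"
    using assms by (intro mat_unit_2x2[OF D]) (auto simp: D_entry intro: unit)
  then show "quasidet_defined ?M 2 2"
    by (simp add: quasidet_defined_def)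

  define v where "v = vec 2 (\<lambda>k. if k = 0 then - (uinv (c (j+1) j) * c (j+1) (j+2))
                                  else uinv (c j (j+1)) * c j (j+2))"
  have recursion: "c x j * v $ 0 + c x (j+1) * v $ 1 = c x (j+2)" if "i \<le> x" "x \<le> i + 2" for x
    using linear_recursion[of j "x + int m"] that assms by (simp add: shift v_def)
  show "quasidet ?M 2 2 = 0"
  proof (rule quasidet_eq_0I)
    show "mat_unit ?D" by fact
    show "v \<in> carrier_vec (dim_col ?M - 1)" by (simp add: v_def neighbouring_mat_def)
    show "?D *\<^sub>v v = col_delete ?M 2 2"
    proof (rule eq_vecI)
      fix p assume "p < dim_vec (col_delete ?M 2 2)"
      then have p: "p < 2" by (simp add: col_delete_def neighbouring_mat_def)
      then have "(?D *\<^sub>v v) $ p = c (i + int p) j * v $ 0 + c (i + int p) (j+1) * v $ 1"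
        using dims D_entry[of p] by (simp add: scalar_prod_vec2 v_def)
      then show "(?D *\<^sub>v v) $ p = col_delete ?M 2 2 $ p"
        using p recursion[of "i + int p"] by (simp add: col_delete_def neighbouring_mat_def)
    qed (use D in \<open>simp add: col_delete_def neighbouring_mat_def\<close>)
    have "row_delete ?M 2 2 \<bullet> v = c (i+2) j * v $ 0 + c (i+2) (j+1) * v $ 1"
      by (simp add: scalar_prod_vec2 v_def row_delete_def neighbouring_mat_def)
    then show "row_delete ?M 2 2 \<bullet> v = ?M $$ (2, 2)"
      using recursion[of "i+2"] by (simp add: neighbouring_mat_def)
  qed
qed

end

theorem corollary6p4:
  fixes c :: "int \<Rightarrow> int \<Rightarrow> 'a::{ring,monoid_mult}"
    and m :: nat
  assumes "m \<ge> 3"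
    and "nc_frieze m c"
  shows "(\<forall>i j. i + 2 \<le> j \<and> j \<le> i + int m - 2 \<longrightarrow>
            quasidet_defined (neighbouring_mat c i j) 2 2 \<and>
            quasidet (neighbouring_mat c i j) 2 2 = 0)
         \<and> tame m c"
proof -
  interpret noncommutative_frieze m c
    using assms(2) by unfold_locales
  have main: "quasidet_defined (neighbouring_mat c i j) 2 2 \<and>
      quasidet (neighbouring_mat c i j) 2 2 = 0" if "i + 2 \<le> j" "j \<le> i + int m - 2" for i j
    using neighbouring_quasidet[OF that] by simp
  \<comment> \<open>A window lies inside the array iff its lower left and its upper right corner do.\<close>
  moreover have "i + 2 \<le> j \<and> j \<le> i + int m - 2"
    if "\<forall>r\<in>{i..i+2}. \<forall>s\<in>{j..j+2}. in_array m r s" for i j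
  proof -
    have "in_array m (i+2) j" "in_array m i (j+2)" using that by auto
    then show ?thesis by (auto simp: in_array_def)
  qed
  ultimately show ?thesis unfolding tame_def by blast
qed

end
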